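(* Let $2\le r\le\infty$ and let $\mathbb{T}=\mathbb{R}/\mathbb{Z}$ be the circle. It is not true that for every neighborhood $\mathcal{N}\subset\mathrm{Diff}^r(\mathbb{T})$ of the identity, every $G\in\mathrm{Diff}^r_c(\mathbb{T})$ is a total renormalization of some $g\in\mathcal{N}$. In other words, there exist a neighborhood $\mathcal{N}$ of the identity in $\mathrm{Diff}^r(\mathbb{T})$ and a diffeomorphism $G\in\mathrm{Diff}^r_c(\mathbb{T})=\mathrm{Diff}^r_0(\mathbb{T})$ such that $G$ is not a total renormalization of any $g\in\mathcal{N}$.
   Context: $\mathrm{Diff}^r(V)$ has the $C^r$-topology and $\mathrm{Diff}^r_0(V)$ is its identity component; $\mathrm{Diff}^r_c(V)$ is the set of maps isotopic to $\mathrm{id}$ through isotopies with support compact in $V\setminus\partial V$, so it equals $\mathrm{Diff}^r_0(V)$ when $V$ is compact without boundary. Total renormalization: $G\in\mathrm{Diff}^r(V)$ is a total renormalization of $g\in\mathrm{Diff}^r(V)$ if there is a strict submanifold with corners $\Delta\subsetneq V$ and a bijective local $C^r$-diffeomorphism $H:\Delta\to V$ such that the first return time $\tau:\Delta\to\mathbb{N}^*$ into $\Delta$ by $g$ is (well defined and) bounded, $G=H\circ g^\tau\circ H^{-1}$, and $\bigcup_{n\ge0}g^n(\Delta)=V$. *)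

theory Defs
  imports "HOL-Analysis.Analysis" "HOL-Library.Extended_Nat"
begin

section \<open>The circle \<open>\<real>/\<int>\<close>\<close>

quotient_type circle = real / "\<lambda>x y. x - y \<in> \<int>"
proof (rule equivpI)
  show "reflp (\<lambda>x y::real. x - y \<in> \<int>)"
    by (simp add: reflp_def)
  show "symp (\<lambda>x y::real. x - y \<in> \<int>)"
    by (rule sympI) (metis Ints_minus minus_diff_eq)
  show "transp (\<lambda>x y::real. x - y \<in> \<int>)"
  proof (rule transpI)
    fix x y z :: real assume "x - y \<in> \<int>" "y - z \<in> \<int>"
    then have "(x - y) + (y - z) \<in> \<int>" by (rule Ints_add)
    then show "x - z \<in> \<int>" by simp
  qed
qed

lift_definition circle_of :: "real \<Rightarrow> circle" is "\<lambda>x. x" .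

lemma circle_of_eq_iff: "circle_of x = circle_of y \<longleftrightarrow> x - y \<in> \<int>"
  by transfer simp

lemma surj_circle_of: "surj circle_of"
  unfolding surj_def
proof
  show "\<exists>x. y = circle_of x" for y
    by transfer (rule_tac x = y in exI, simp)
qed

instantiation circle :: topological_space
begin

definition open_circle :: "circle set \<Rightarrow> bool" where
  "open_circle U \<longleftrightarrow> open (circle_of -` U)"

instance
proof
  fix K :: "circle set set"
  assume "\<forall>S\<in>K. open S"
  then show "open (\<Union>K)"
    unfolding open_circle_def vimage_Union by (intro open_UN) auto
qed (auto simp: open_circle_def vimage_Int)

end

section \<open>Maps of class \<open>C\<^sup>r\<close>\<close>

text \<open>All sets \<open>S\<close> to which the following notion is applied are open, so that the iterated
  derivatives at a point of \<open>S\<close> only depend on the restriction of \<open>F\<close> to \<open>S\<close>.\<close>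

definition Cr_on :: "enat \<Rightarrow> (real \<Rightarrow> real) \<Rightarrow> real set \<Rightarrow> bool" where
  "Cr_on r F S \<longleftrightarrow>
     (\<forall>k. enat k \<le> r \<longrightarrow> continuous_on S ((deriv ^^ k) F)) \<and>
     (\<forall>k. enat k < r \<longrightarrow> (\<forall>x\<in>S. (deriv ^^ k) F field_differentiable (at x)))"

definition Cr_diffeo_onto_image :: "enat \<Rightarrow> (real \<Rightarrow> real) \<Rightarrow> real set \<Rightarrow> bool" where
  "Cr_diffeo_onto_image r F S \<longleftrightarrow>
     open S \<and> open (F ` S) \<and> inj_on F S \<and> Cr_on r F S \<and> Cr_on r (inv_into S F) (F ` S)"

text \<open>The charts of the circle are the local inverses of \<^const>\<open>circle_of\<close>; the function \<open>F\<close>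
  below is the expression of \<open>f\<close> in such charts.\<close>

definition Cr_map :: "enat \<Rightarrow> (circle \<Rightarrow> circle) \<Rightarrow> bool" where
  "Cr_map r f \<longleftrightarrow>
     (\<forall>x. \<exists>\<epsilon>>0. \<exists>F. Cr_on r F (ball x \<epsilon>) \<and>
        (\<forall>y\<in>ball x \<epsilon>. f (circle_of y) = circle_of (F y)))"

definition Diff :: "enat \<Rightarrow> (circle \<Rightarrow> circle) set" where
  "Diff r = {f. bij f \<and> Cr_map r f \<and> Cr_map r (inv f)}"

section \<open>The \<open>C\<^sup>r\<close>-topology on the group of diffeomorphisms\<close>

definition Cr_lift :: "enat \<Rightarrow> (circle \<Rightarrow> circle) \<Rightarrow> (real \<Rightarrow> real) \<Rightarrow> bool" where
  "Cr_lift r f F \<longleftrightarrow> Cr_on r F UNIV \<and> (\<forall>x. f (circle_of x) = circle_of (F x))"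

text \<open>Two maps are \<open>\<epsilon>\<close>-close in the \<open>C\<^sup>k\<close>-sense if they have lifts to the universal cover
  that are uniformly \<open>\<epsilon>\<close>-close together with their first \<open>k\<close> derivatives. Continuous lifts are
  unique up to an integer constant, so only the order \<open>0\<close> condition depends on their choice.\<close>

definition Ck_close :: "nat \<Rightarrow> real \<Rightarrow> (circle \<Rightarrow> circle) \<Rightarrow> (circle \<Rightarrow> circle) \<Rightarrow> bool" where
  "Ck_close k \<epsilon> f g \<longleftrightarrow>
     (\<exists>F G. Cr_lift (enat k) f F \<and> Cr_lift (enat k) g G \<and>
        (\<forall>j\<le>k. \<forall>x. \<bar>(deriv ^^ j) F x - (deriv ^^ j) G x\<bar> < \<epsilon>))"

text \<open>For \<open>r = \<infinity>\<close> this is the topology generated by the \<open>C\<^sup>k\<close>-topologies for all finite \<open>k\<close>.\<close>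

definition Cr_topology :: "enat \<Rightarrow> (circle \<Rightarrow> circle) topology" where
  "Cr_topology r = topology (\<lambda>U. U \<subseteq> Diff r \<and>
     (\<forall>f\<in>U. \<exists>k \<epsilon>. enat k \<le> r \<and> 0 < \<epsilon> \<and> {g \<in> Diff r. Ck_close k \<epsilon> f g} \<subseteq> U))"

lemma Cr_on_mono: "Cr_on s F S" if "Cr_on r F S" "s \<le> r"
  using that unfolding Cr_on_def by (auto dest: order.trans less_le_trans)

lemma Ck_close_mono: "Ck_close j \<delta> f g" if close: "Ck_close k \<epsilon> f g" and le: "j \<le> k" "\<epsilon> \<le> \<delta>"
proof -
  obtain F G where "Cr_lift (enat k) f F" "Cr_lift (enat k) g G"
    and *: "\<forall>i\<le>k. \<forall>x. \<bar>(deriv ^^ i) F x - (deriv ^^ i) G x\<bar> < \<epsilon>"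
    using close unfolding Ck_close_def by blast
  then have "Cr_lift (enat j) f F" "Cr_lift (enat j) g G"
    using le by (auto simp: Cr_lift_def intro: Cr_on_mono)
  moreover have "\<forall>i\<le>j. \<forall>x. \<bar>(deriv ^^ i) F x - (deriv ^^ i) G x\<bar> < \<delta>"
    using * le by (meson order.trans less_le_trans)
  ultimately show ?thesis unfolding Ck_close_def by blast
qed

lemma openin_Cr_topology:
  "openin (Cr_topology r) U \<longleftrightarrow> U \<subseteq> Diff r \<and>
     (\<forall>f\<in>U. \<exists>k \<epsilon>. enat k \<le> r \<and> 0 < \<epsilon> \<and> {g \<in> Diff r. Ck_close k \<epsilon> f g} \<subseteq> U)"
proof -
  define P where "P = (\<lambda>U. U \<subseteq> Diff r \<and>
     (\<forall>f\<in>U. \<exists>k \<epsilon>. enat k \<le> r \<and> 0 < \<epsilon> \<and> {g \<in> Diff r. Ck_close k \<epsilon> f g} \<subseteq> U))"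
  have "istopology P"
    unfolding istopology_def
  proof (intro conjI allI impI)
    fix S T assume S: "P S" and T: "P T"
    show "P (S \<inter> T)"
      unfolding P_def
    proof (intro conjI ballI)
      show "S \<inter> T \<subseteq> Diff r" using S by (auto simp: P_def)
      fix f assume f: "f \<in> S \<inter> T"
      obtain k \<epsilon> where 1: "enat k \<le> r" "0 < \<epsilon>" "{g \<in> Diff r. Ck_close k \<epsilon> f g} \<subseteq> S"
        using S f unfolding P_def by blast
      obtain l \<delta> where 2: "enat l \<le> r" "0 < \<delta>" "{g \<in> Diff r. Ck_close l \<delta> f g} \<subseteq> T"
        using T f unfolding P_def by blast
      have "{g \<in> Diff r. Ck_close (max k l) (min \<epsilon> \<delta>) f g} \<subseteq> S \<inter> T"
        using 1(3) 2(3) Ck_close_mono[of "max k l" "min \<epsilon> \<delta>" f _ k \<epsilon>]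
          Ck_close_mono[of "max k l" "min \<epsilon> \<delta>" f _ l \<delta>] by auto
      moreover have "enat (max k l) \<le> r" using 1(1) 2(1) by (simp add: max_def)
      ultimately show "\<exists>k \<epsilon>. enat k \<le> r \<and> 0 < \<epsilon> \<and> {g \<in> Diff r. Ck_close k \<epsilon> f g} \<subseteq> S \<inter> T"
        using 1(2) 2(2) by (intro exI[of _ "max k l"] exI[of _ "min \<epsilon> \<delta>"]) simp
    qed
  next
    fix K assume "\<forall>S\<in>K. P S"
    then have K: "P S" if "S \<in> K" for S using that by blast
    show "P (\<Union>K)"
      unfolding P_def
    proof (intro conjI ballI)
      show "\<Union>K \<subseteq> Diff r" using K unfolding P_def by blast
      fix f assume "f \<in> \<Union>K"
      then obtain S where S: "S \<in> K" "f \<in> S" by blast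
      then obtain k \<epsilon> where "enat k \<le> r" "0 < \<epsilon>" "{g \<in> Diff r. Ck_close k \<epsilon> f g} \<subseteq> S"
        using K[OF S(1)] unfolding P_def by blast
      moreover have "S \<subseteq> \<Union>K" using S(1) by blast
      ultimately show "\<exists>k \<epsilon>. enat k \<le> r \<and> 0 < \<epsilon> \<and> {g \<in> Diff r. Ck_close k \<epsilon> f g} \<subseteq> \<Union>K"
        by (intro exI[of _ k] exI[of _ \<epsilon>]) auto
    qed
  qed
  then show ?thesis
    by (simp add: Cr_topology_def P_def topology_inverse')
qed

definition Cr_neighborhood_of_id :: "enat \<Rightarrow> (circle \<Rightarrow> circle) set \<Rightarrow> bool" where
  "Cr_neighborhood_of_id r N \<longleftrightarrow>
     N \<subseteq> Diff r \<and> (\<exists>U. openin (Cr_topology r) U \<and> id \<in> U \<and> U \<subseteq> N)"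

definition Diff_0 :: "enat \<Rightarrow> (circle \<Rightarrow> circle) set" where
  "Diff_0 r = connected_component_of_set (Cr_topology r) id"

text \<open>Isotopies are continuous paths in the \<open>C\<^sup>r\<close>-topology. The circle has no boundary, so the
  support only has to be compact (which, by compactness of the circle, is automatic).\<close>

definition Diff_c :: "enat \<Rightarrow> (circle \<Rightarrow> circle) set" where
  "Diff_c r = {f. \<exists>h. pathin (Cr_topology r) h \<and> h 0 = id \<and> h 1 = f \<and>
     compact (closure {x. \<exists>t\<in>{0..1}. h t x \<noteq> x})}"

section \<open>Total renormalization\<close>

text \<open>Submanifolds with corners of the same dimension as the circle: in suitable charts
  \<open>\<phi>\<close> of the circle they coincide with the model \<open>[0, \<infinity>)\<close>. Interior points are those with
  \<open>\<phi> x > 0\<close>. Such a set is locally closed but need not be closed; for instance,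
  half-open arcs are allowed.\<close>

definition submanifold_with_corners :: "enat \<Rightarrow> circle set \<Rightarrow> bool" where
  "submanifold_with_corners r \<Delta> \<longleftrightarrow>
     (\<forall>x. circle_of x \<in> \<Delta> \<longrightarrow>
        (\<exists>\<epsilon>>0. \<exists>\<phi>. Cr_diffeo_onto_image r \<phi> (ball x \<epsilon>) \<and>
           (\<forall>y\<in>ball x \<epsilon>. circle_of y \<in> \<Delta> \<longleftrightarrow> \<phi> y \<in> {0..})))"

text \<open>As usual for domains with boundary, a local diffeomorphism is a map that near each point of
  its domain, boundary points included, is the restriction of a diffeomorphism between open sets of
  the ambient manifolds.\<close>

definition local_Cr_diffeo :: "enat \<Rightarrow> circle set \<Rightarrow> (circle \<Rightarrow> circle) \<Rightarrow> bool" where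
  "local_Cr_diffeo r \<Delta> H \<longleftrightarrow>
     (\<forall>x. circle_of x \<in> \<Delta> \<longrightarrow>
        (\<exists>\<epsilon>>0. \<exists>F. Cr_diffeo_onto_image r F (ball x \<epsilon>) \<and>
           (\<forall>y\<in>ball x \<epsilon>. circle_of y \<in> \<Delta> \<longrightarrow> H (circle_of y) = circle_of (F y))))"

definition first_return_time :: "('a \<Rightarrow> 'a) \<Rightarrow> 'a set \<Rightarrow> 'a \<Rightarrow> nat" where
  "first_return_time g \<Delta> x = (LEAST n. 0 < n \<and> (g ^^ n) x \<in> \<Delta>)"

definition bounded_first_return :: "('a \<Rightarrow> 'a) \<Rightarrow> 'a set \<Rightarrow> bool" where
  "bounded_first_return g \<Delta> \<longleftrightarrow>
     (\<forall>x\<in>\<Delta>. \<exists>n>0. (g ^^ n) x \<in> \<Delta>) \<and> (\<exists>B. \<forall>x\<in>\<Delta>. first_return_time g \<Delta> x \<le> B)"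

definition first_return_map :: "('a \<Rightarrow> 'a) \<Rightarrow> 'a set \<Rightarrow> 'a \<Rightarrow> 'a" where
  "first_return_map g \<Delta> x = (g ^^ first_return_time g \<Delta> x) x"

definition total_renormalization :: "enat \<Rightarrow> (circle \<Rightarrow> circle) \<Rightarrow> (circle \<Rightarrow> circle) \<Rightarrow> bool" where
  "total_renormalization r G g \<longleftrightarrow> G \<in> Diff r \<and> g \<in> Diff r \<and>
     (\<exists>\<Delta> H. submanifold_with_corners r \<Delta> \<and> \<Delta> \<subset> UNIV \<and>
        bij_betw H \<Delta> UNIV \<and> local_Cr_diffeo r \<Delta> H \<and>
        bounded_first_return g \<Delta> \<and>
        G = H \<circ> first_return_map g \<Delta> \<circ> inv_into \<Delta> H \<and>
        (\<Union>n. (g ^^ n) ` \<Delta>) = UNIV)"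

end

theory Submission
  imports Defs
begin

text \<open>Let \<open>G\<close> have the lift \<open>x - sin (2 \<pi> x) / (4 \<pi>)\<close>, which fixes \<open>0\<close> with multiplier \<open>1/2\<close>. If \<open>G\<close> is a total
  renormalization of \<open>g\<close> through \<open>H\<close>, then \<open>q = H\<inverse> 0\<close> is a periodic point of \<open>g\<close> whose period is its
  return time \<open>n\<close>, and the multiplier \<open>(g\<^sup>n)' q\<close> equals \<open>1/2\<close> since multipliers are invariant
  under conjugacy. But the interval from \<open>q\<close> to its neighbour in the orbit is mapped by \<open>g\<^sup>n\<close> onto
  itself, so \<open>g\<^sup>n\<close> has slope at least \<open>1\<close> somewhere on it, while the first \<open>n\<close> iterates of this interval
  are disjoint; hence the distortion of \<open>g\<^sup>n\<close> there is bounded by the \<open>C\<^sup>2\<close>-distance from \<open>g\<close> to the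
  rotations, independently of \<open>n\<close>. For \<open>g\<close> close to the identity this contradicts the multiplier \<open>1/2\<close>.\<close>

section \<open>Multipliers of periodic points\<close>

lemma circle_of_funpow:
  assumes "\<And>x. g (circle_of x) = circle_of (F x)"
  shows "(g ^^ i) (circle_of x) = circle_of ((F ^^ i) x)"
  by (induction i) (simp_all add: assms)

lemma funpow_has_real_derivative:
  fixes F F' :: "real \<Rightarrow> real"
  assumes "\<And>x. (F has_real_derivative F' x) (at x)"
  shows "((F ^^ i) has_real_derivative (\<Prod>j<i. F' ((F ^^ j) x))) (at x)"
proof (induction i)
  case 0
  show ?case by (simp add: id_def)
next
  case (Suc i)
  have "((\<lambda>x. F ((F ^^ i) x)) has_real_derivative F' ((F ^^ i) x) * (\<Prod>j<i. F' ((F ^^ j) x))) (at x)"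
    by (rule DERIV_chain2[OF assms Suc])
  then show ?case by (simp add: o_def mult.commute)
qed

lemma strict_mono_if_deriv_pos:
  fixes F F' :: "real \<Rightarrow> real"
  assumes "\<And>x. (F has_real_derivative F' x) (at x)" "\<And>x. F' x > 0"
  shows "strict_mono F"
  by (rule strict_monoI) (meson DERIV_pos_imp_increasing assms)

text \<open>Additivity of Lebesgue measure. Half-open intervals keep neighbours that share an
  endpoint disjoint.\<close>

lemma sum_length_disjoint_intervals_le:
  fixes a b :: "'i \<Rightarrow> real"
  assumes "finite I" "disjoint_family_on (\<lambda>i. {a i..<b i}) I"
    and "\<And>i. i \<in> I \<Longrightarrow> a i \<le> b i" "\<And>i. i \<in> I \<Longrightarrow> {a i..<b i} \<subseteq> {c..<d}" "c \<le> d"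
  shows "(\<Sum>i\<in>I. b i - a i) \<le> d - c"
proof -
  have "(\<Sum>i\<in>I. b i - a i) = (\<Sum>i\<in>I. measure lborel {a i..<b i})"
    using assms(3) by (intro sum.cong) auto
  also have "\<dots> = measure lborel (\<Union>i\<in>I. {a i..<b i})"
    using assms by (intro measure_finite_Union[symmetric]) auto
  also have "\<dots> \<le> measure lborel {c..<d}"
  proof (rule measure_mono_fmeasurable)
    show "(\<Union>i\<in>I. {a i..<b i}) \<subseteq> {c..<d}" using assms(4) by blast
  qed (use assms(1) in \<open>auto simp: fmeasurable_def emeasure_lborel_Ico assms(5)\<close>)
  finally show ?thesis using assms(5) by simp
qed

text \<open>The gaps following the \<open>n\<close> orbit points have total length at most
  \<open>2\<close>, so on the gap to the right of \<open>q\<close> the slope of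
  \<open>F ^^ n\<close> exceeds its value at \<open>q\<close> by a factor of at most
  \<open>exp (2/9) < 2\<close>. Somewhere on that gap the slope is at least
  \<open>1\<close>.\<close>

lemma periodic_point_multiplier_gt_half:
  fixes F F' :: "real \<Rightarrow> real"
  assumes lift: "\<And>x. g (circle_of x) = circle_of (F x)" and inj: "inj g"
    and der: "\<And>x. (F has_real_derivative F' x) (at x)"
    and near1: "\<And>x. \<bar>F' x - 1\<bar> \<le> 1/10"
    and lip: "\<And>x y. \<bar>F' x - F' y\<bar> \<le> \<bar>x - y\<bar> / 10"
    and n: "n > 0" "(g ^^ n) (circle_of q) = circle_of q"
    and least: "\<And>m. 0 < m \<Longrightarrow> m < n \<Longrightarrow> (g ^^ m) (circle_of q) \<noteq> circle_of q"
  shows "(\<Prod>j<n. F' ((F ^^ j) q)) > 1/2"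
proof -
  define c where "c = circle_of q"
  \<comment> \<open>\<open>X\<close> is the set of all lifts of orbit points to the line, invariant
    under integer translations and under \<open>F\<close> in both directions.\<close>
  define X where "X = {x. \<exists>m. circle_of x = (g ^^ m) c}"
  have F'pos: "F' x \<ge> 9/10" for x using near1[of x] by linarith
  have F'pos': "F' x > 0" for x using F'pos[of x] by linarith
  have smono: "strict_mono (F ^^ i)" for i
    by (rule strict_mono_if_deriv_pos[OF funpow_has_real_derivative[OF der]])
      (auto intro: prod_pos F'pos')
  have cont: "isCont (F ^^ i) x" for i x
    by (rule DERIV_isCont[OF funpow_has_real_derivative[OF der]])
  note pow = circle_of_funpow[of g F, OF lift]
  have injp: "inj (g ^^ i)" for i by (rule inj_fn[OF inj])
  have period: "(g ^^ (m mod n)) c = (g ^^ m) c" for m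
    using funpow_mod_eq[of n g c m] n by (simp add: c_def)
  have distinct: "i = j" if "(g ^^ i) c = (g ^^ j) c" "i < n" "j < n" for i j
    using that
  proof (induction i j rule: linorder_wlog)
    case (le i j)
    have "(g ^^ i) ((g ^^ (j - i)) c) = (g ^^ i) c"
      using le by (simp flip: funpow_add o_apply[of "g^^i"])
    then have "(g ^^ (j - i)) c = c" using injp[of i] by (simp add: inj_eq)
    then show ?case using least[of "j - i"] le by (cases "i = j") (auto simp: c_def)
  qed auto
  have Oint: "x + of_int k \<in> X" if "x \<in> X" for x k
  proof -
    have "circle_of (x + of_int k) = circle_of x" by (simp add: circle_of_eq_iff)
    then show ?thesis using that by (simp add: X_def)
  qed
  have OF: "(F ^^ i) x \<in> X" if x: "x \<in> X" for i x
  proof -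
    obtain m where "circle_of x = (g ^^ m) c" using x by (auto simp: X_def)
    then have "circle_of ((F ^^ i) x) = (g ^^ (i + m)) c" by (simp add: funpow_add flip: pow)
    then show ?thesis unfolding X_def by blast
  qed
  have OF': "x \<in> X" if x: "(F ^^ i) x \<in> X" for i x
  proof -
    obtain m where "circle_of ((F ^^ i) x) = (g ^^ m) c" using x by (auto simp: X_def)
    then have "(g ^^ i) (circle_of x) = (g ^^ m) c" by (simp flip: pow)
    \<comment> \<open>Adding \<open>n * i\<close> does not change the orbit point and makes the
      exponent at least \<open>i\<close>, so that \<open>g ^^ i\<close> can be cancelled.\<close>
    also have "\<dots> = (g ^^ (m + n * i)) c" using period[of m] period[of "m + n*i"] by simp
    also have "m + n * i = i + (m + n * i - i)"
      using n(1) by (cases n) auto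
    finally have "(g ^^ i) (circle_of x) = (g ^^ i) ((g ^^ (m + n * i - i)) c)"
      by (simp add: funpow_add)
    then show ?thesis using injp[of i] by (auto simp: inj_eq X_def)
  qed
  have qO: "q \<in> X" unfolding X_def c_def by (rule CollectI, rule exI[of _ 0]) simp
  \<comment> \<open>\<open>A\<close> represents each orbit point once, to the right of
    \<open>q\<close>. It is therefore finite, and its minimum \<open>r\<close> is the right
    neighbour of \<open>q\<close> in \<open>X\<close>; for \<open>n = 1\<close> this is
    \<open>q + 1\<close>.\<close>
  define A where "A = {x\<in>X. q < x \<and> x \<le> q + 1}"
  have "inj_on circle_of A"
  proof (rule inj_onI)
    fix x y assume "x \<in> A" "y \<in> A" "circle_of x = circle_of y"
    then obtain z where z: "x - y = of_int z" by (auto simp: circle_of_eq_iff elim: Ints_cases)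
    moreover have "real_of_int z < 1" "real_of_int z > - 1"
      using z \<open>x \<in> A\<close> \<open>y \<in> A\<close> by (auto simp: A_def simp flip: z)
    then have "z = 0" by linarith
    ultimately show "x = y" by simp
  qed
  moreover have "circle_of ` A \<subseteq> (\<lambda>m. (g ^^ m) c) ` {..<n}"
  proof clarify
    fix x assume "x \<in> A"
    then obtain m where "circle_of x = (g ^^ m) c" by (auto simp: X_def A_def)
    then show "circle_of x \<in> (\<lambda>m. (g ^^ m) c) ` {..<n}"
      using period[of m] n(1) by (intro image_eqI[of _ _ "m mod n"]) auto
  qed
  ultimately have fin: "finite A"
    using inj_on_finite by blast
  have "q + 1 \<in> A" using Oint[OF qO, of 1] by (simp add: A_def)
  then have ne: "A \<noteq> {}" by blast
  define r where "r = Min A"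
  have rA: "r \<in> X" "q < r" "r \<le> q + 1"
    using Min_in[OF fin ne] by (auto simp: r_def A_def)
  have gap: "r \<le> x" if "x \<in> X" "q < x" for x
  proof (rule ccontr)
    assume "\<not> r \<le> x"
    then have "x \<in> A" using that rA by (simp add: A_def)
    then show False using Min_le[OF fin] \<open>\<not> r \<le> x\<close> by (simp add: r_def)
  qed
  \<comment> \<open>Since \<open>F ^^ i\<close> is increasing and \<open>X\<close> is invariant,
    gaps of \<open>X\<close> go to gaps: a point of \<open>X\<close> inside the image would come
    from one strictly between \<open>q\<close> and \<open>r\<close>.\<close>
  have gapF: "(F ^^ i) r \<le> y" if y: "y \<in> X" "(F ^^ i) q < y" for i y
  proof (rule ccontr)
    assume "\<not> (F ^^ i) r \<le> y"
    then obtain z where z: "q \<le> z" "z \<le> r" "(F ^^ i) z = y"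
      using IVT[of "F ^^ i" q y r] y rA cont by auto
    then have "z \<in> X" "q \<noteq> z" using OF' y by auto
    then have "r \<le> z" using gap z by auto
    then show False using z \<open>\<not> (F ^^ i) r \<le> y\<close> by auto
  qed
  \<comment> \<open>The integer \<open>k i\<close> moves the left endpoint into the unit interval.
    As \<open>a i + 1\<close> also lies in \<open>X\<close>, each interval has length at most
    \<open>1\<close>, so all of them fit into \<open>{0..<2}\<close>.\<close>
  define k where "k i = - \<lfloor>(F ^^ i) q\<rfloor>" for i
  define a where "a i = (F ^^ i) q + of_int (k i)" for i
  define b where "b i = (F ^^ i) r + of_int (k i)" for i
  have ab: "a i \<le> b i" for i
    using smono[of i] rA by (simp add: a_def b_def strict_mono_less_eq)
  have aO: "a i \<in> X" for i unfolding a_def by (intro Oint OF qO)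
  have gapab: "b i \<le> y" if "y \<in> X" "a i < y" for i y
    using gapF[OF Oint[OF that(1), of "- k i"], of i] that(2) by (simp add: a_def b_def)
  have circ: "circle_of (a i) = (g ^^ i) c" for i
  proof -
    have "circle_of (a i) = circle_of ((F ^^ i) q)" by (simp add: a_def circle_of_eq_iff)
    then show ?thesis by (simp add: pow c_def)
  qed
  have disj: "{a i..<b i} \<inter> {a j..<b j} = {}" if "i < n" "j < n" "i \<noteq> j" for i j
    using that
  proof (induction "a i" "a j" arbitrary: i j rule: linorder_wlog)
    case le
    have "a i \<noteq> a j" using circ[of i] circ[of j] distinct[of i j] le by auto
    then have "b i \<le> a j" using gapab[OF aO, of i j] le by simp
    then show ?case by auto
  next
    case (sym j i)
    then show ?case by (metis Int_commute)
  qed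
  have sub: "{a i..<b i} \<subseteq> {0..<2}" for i
  proof -
    have "0 \<le> a i" "a i < 1" unfolding a_def k_def by linarith+
    moreover have "b i \<le> a i + 1" using gapab[OF Oint[OF aO, of _ 1], of i i] by simp
    ultimately show ?thesis by auto
  qed
  have "(\<Sum>i<n. b i - a i) \<le> 2 - 0"
    using ab sub disj
    by (intro sum_length_disjoint_intervals_le) (auto simp: disjoint_family_on_def)
  then have total: "(\<Sum>i<n. (F ^^ i) r - (F ^^ i) q) \<le> 2" by (simp add: a_def b_def)
  let ?P = "\<lambda>x. \<Prod>j<n. F' ((F ^^ j) x)"
  have Pq: "0 < ?P q" using F'pos' by (simp add: prod_pos)
  obtain z where z: "q < z" "z < r" "(F ^^ n) r - (F ^^ n) q = (r - q) * ?P z"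
    using MVT2[OF rA(2), of "F ^^ n" ?P] funpow_has_real_derivative[OF der] by blast
  \<comment> \<open>\<open>F ^^ n\<close> moves \<open>q\<close> by an integer \<open>l\<close>.
    Translated back by \<open>l\<close>, the image of \<open>r\<close> is a point of
    \<open>X\<close> beyond \<open>q\<close>, hence not before \<open>r\<close>: the gap does not
    shrink, so the slope at the mean value point \<open>z\<close> is at least
    \<open>1\<close>.\<close>
  have "(F ^^ n) q - q \<in> \<int>" using n(2) by (simp add: pow circle_of_eq_iff)
  then obtain l where l: "(F ^^ n) q - q = of_int l" by (auto elim: Ints_cases)
  have "(F ^^ n) q < (F ^^ n) r" using smono[of n] rA by (simp add: strict_mono_less)
  then have "r \<le> (F ^^ n) r - of_int l"
    using gap[OF Oint[OF OF[OF rA(1)], of n "- l"]] l by simp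
  then have "(r - q) * 1 \<le> (r - q) * ?P z" using z(3) l by simp
  then have "1 \<le> ?P z" using rA by simp
  \<comment> \<open>The constant \<open>1/9\<close> is the Lipschitz constant \<open>1/10\<close>
    divided by the lower bound \<open>9/10\<close> for \<open>F'\<close>, which turns an additive
    error into a multiplicative one.\<close>
  also have "?P z \<le> (\<Prod>i<n. F' ((F ^^ i) q) * exp (((F ^^ i) r - (F ^^ i) q) / 9))"
  proof (intro prod_mono conjI)
    fix i assume "i \<in> {..<n}"
    let ?x = "(F ^^ i) z" and ?y = "(F ^^ i) q" and ?w = "(F ^^ i) r"
    show "0 \<le> F' ?x" using F'pos'[of ?x] by simp
    have o: "?y < ?x" "?x < ?w" using smono[of i] z by (simp_all add: strict_mono_less)
    have "F' ?x \<le> F' ?y + (?w - ?y) / 10" using abs_le_D1[OF lip[of ?x ?y]] o by (simp add: field_simps)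
    also have "(?w - ?y) / 10 \<le> F' ?y * ((?w - ?y) / 9)"
      using mult_right_mono[OF F'pos[of ?y], of "(?w - ?y) / 9"] o by simp
    also have "F' ?y + F' ?y * ((?w - ?y) / 9) = F' ?y * (1 + (?w - ?y) / 9)"
      by (simp add: algebra_simps)
    also have "\<dots> \<le> F' ?y * exp ((?w - ?y) / 9)"
      using F'pos'[of ?y] by (intro mult_left_mono exp_ge_add_one_self) auto
    finally show "F' ?x \<le> F' ?y * exp ((?w - ?y) / 9)" by simp
  qed
  also have "\<dots> = ?P q * exp ((\<Sum>i<n. (F ^^ i) r - (F ^^ i) q) / 9)"
    by (simp add: prod.distrib exp_sum sum_divide_distrib)
  also have "\<dots> \<le> ?P q * exp (2/9)"
    using total Pq by (intro mult_left_mono) auto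
  also have "\<dots> < ?P q * 2"
  proof -
    have "exp (2/9::real) \<le> 1 + 2/9 + (2/9)\<^sup>2" by (rule exp_bound) auto
    also have "\<dots> < 2" by (simp add: power2_eq_square)
    finally show ?thesis using Pq by (intro mult_strict_left_mono)
  qed
  finally show ?thesis by simp
qed

section \<open>First returns near a fixed point\<close>

text \<open>Differentiating \<open>inv_into S E (E x) = x\<close> shows that the two derivatives are
  mutually inverse.\<close>

lemma Cr_diffeo_has_nonzero_deriv:
  assumes E: "Cr_diffeo_onto_image r E S" and r: "1 \<le> r" and x: "x \<in> S"
  obtains d where "d \<noteq> 0" "(E has_real_derivative d) (at x)"
    "(inv_into S E has_real_derivative inverse d) (at (E x))"
proof -
  have S: "open S" "open (E ` S)" "inj_on E S" and E': "Cr_on r E S" "Cr_on r (inv_into S E) (E ` S)"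
    using E by (auto simp: Cr_diffeo_onto_image_def)
  have r0: "enat 0 < r" using r by (cases r) (auto simp: one_enat_def)
  obtain d where d: "(E has_real_derivative d) (at x)"
    using E'(1) r0 x unfolding Cr_on_def field_differentiable_def
    by (metis funpow_0)
  obtain e where e: "(inv_into S E has_real_derivative e) (at (E x))"
    using E'(2) r0 x unfolding Cr_on_def field_differentiable_def
    by (metis funpow_0 image_eqI)
  have "((\<lambda>y. inv_into S E (E y)) has_real_derivative e * d) (at x)"
    by (rule DERIV_chain2[OF e d])
  then have "((\<lambda>y. y) has_real_derivative e * d) (at x)"
    by (rule has_field_derivative_transform_within_open[OF _ S(1) x]) (use S(3) in simp)
  then have "e * d = 1" using DERIV_ident DERIV_unique by blast
  then have "d \<noteq> 0" "e = inverse d" by (auto simp: inverse_eq_divide eq_divide_eq)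
  then show ?thesis using that d e by blast
qed

text \<open>The chart has nonzero derivative \<open>d\<close> and a nonnegative value at
  \<open>q\<close>, so it stays nonnegative when moving in the direction \<open>sgn d\<close>.
  Interior and boundary points are treated alike.\<close>

lemma one_sided_in_submanifold:
  assumes "submanifold_with_corners r \<Delta>" "1 \<le> r" "circle_of q \<in> \<Delta>"
  obtains \<sigma> \<delta> :: real where "\<sigma> = 1 \<or> \<sigma> = -1" "\<delta> > 0"
    "\<And>t. 0 < t \<Longrightarrow> t < \<delta> \<Longrightarrow> circle_of (q + \<sigma> * t) \<in> \<Delta>"
proof -
  obtain \<epsilon> \<phi> where \<epsilon>: "\<epsilon> > 0" and \<phi>: "Cr_diffeo_onto_image r \<phi> (ball q \<epsilon>)"
    and iff: "\<forall>y\<in>ball q \<epsilon>. circle_of y \<in> \<Delta> \<longleftrightarrow> \<phi> y \<in> {0..}"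
    using assms(1,3) unfolding submanifold_with_corners_def by blast
  obtain d where d: "d \<noteq> 0" "(\<phi> has_real_derivative d) (at q)"
    using Cr_diffeo_has_nonzero_deriv[OF \<phi> assms(2), of q] \<epsilon> by auto
  have "((\<lambda>t. \<phi> (q + sgn d * t)) has_real_derivative d * sgn d) (at 0)"
    by (rule DERIV_chain2[of \<phi>]) (auto intro!: derivative_eq_intros d(2))
  moreover have "d * sgn d > 0" using d(1) by (simp add: sgn_if)
  ultimately obtain \<eta> where \<eta>: "\<eta> > 0" "\<And>t. 0 < t \<Longrightarrow> t < \<eta> \<Longrightarrow> \<phi> q < \<phi> (q + sgn d * t)"
    using DERIV_pos_inc_right by force
  have "\<phi> q \<ge> 0" using iff assms(3) \<epsilon> by auto
  show ?thesis
  proof (rule that[of "sgn d" "min \<eta> \<epsilon>"])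
    show "sgn d = 1 \<or> sgn d = -1" using d(1) by (simp add: sgn_if)
    show "0 < min \<eta> \<epsilon>" using \<eta> \<epsilon> by simp
    fix t assume t: "0 < t" "t < min \<eta> \<epsilon>"
    have "q + sgn d * t \<in> ball q \<epsilon>" using t by (simp add: dist_real_def sgn_if)
    then show "circle_of (q + sgn d * t) \<in> \<Delta>" using iff \<eta>(2)[of t] t \<open>\<phi> q \<ge> 0\<close> by auto
  qed
qed

text \<open>The positive slope gives the lower bound and continuity the upper one. This keeps
  displacements on the side of \<open>q\<close> that belongs to the submanifold.\<close>

lemma eventually_at_right_pos_small:
  fixes f :: "real \<Rightarrow> real"
  assumes "(f has_real_derivative l) (at 0)" "f 0 = 0" "l > 0" "\<delta> > 0"
  shows "eventually (\<lambda>t. 0 < f t \<and> f t < \<delta>) (at_right 0)"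
proof -
  obtain d where "d > 0" "\<And>h. 0 < h \<Longrightarrow> h < d \<Longrightarrow> f 0 < f (0 + h)"
    using DERIV_pos_inc_right[OF assms(1,3)] by blast
  then have "eventually (\<lambda>t. 0 < f t) (at_right 0)"
    using assms(2) by (auto simp: eventually_at_right_field intro!: exI[of _ d])
  moreover have "(f \<longlongrightarrow> 0) (at_right 0)"
    using DERIV_isCont[OF assms(1)] assms(2)
    by (metis filterlim_at_split isCont_def)
  then have "eventually (\<lambda>t. f t < \<delta>) (at_right 0)"
    using assms(4) by (rule order_tendstoD)
  ultimately show ?thesis by eventually_elim simp
qed

text \<open>The return time may jump at \<open>q\<close>, and \<open>H\<inverse>\<close> may be discontinuous at \<open>H q\<close>. But \<open>\<Delta>\<close> contains a
  one-sided neighbourhood of \<open>q\<close>, which the local expression of \<open>H\<inverse> \<circ> G \<circ> H\<close> preserves because its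
  multiplier is positive; there it must coincide with \<open>g\<^sup>n\<close>.\<close>

lemma first_return_multiplier_eq:
  fixes F Gl :: "real \<Rightarrow> real"
  assumes \<Delta>: "submanifold_with_corners r \<Delta>" and r: "1 \<le> r" and q: "circle_of q \<in> \<Delta>"
    and H: "inj_on H \<Delta>" "local_Cr_diffeo r \<Delta> H"
    and G: "G = H \<circ> first_return_map g \<Delta> \<circ> inv_into \<Delta> H"
    and ret: "\<And>x. x \<in> \<Delta> \<Longrightarrow> \<exists>n>0. (g ^^ n) x \<in> \<Delta>"
    and g: "\<And>x. g (circle_of x) = circle_of (F x)"
    and Gl: "\<And>x. G (circle_of x) = circle_of (Gl x)"
    and Glfix: "\<And>y. circle_of y = H (circle_of q) \<Longrightarrow> Gl y = y \<and> (Gl has_real_derivative \<mu>) (at y)"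
    and \<mu>: "\<mu> > 0"
    and F: "\<And>m. isCont (F ^^ m) q"
    and n_def: "n = first_return_time g \<Delta> (circle_of q)"
    and FD: "((F ^^ n) has_real_derivative D) (at q)" and D: "D > 0"
  shows "D = \<mu>" "n > 0" "(g ^^ n) (circle_of q) = circle_of q"
    "\<And>m. 0 < m \<Longrightarrow> m < n \<Longrightarrow> (g ^^ m) (circle_of q) \<noteq> circle_of q"
proof -
  define R where "R = first_return_map g \<Delta>"
  note pow = circle_of_funpow[of g F, OF g]
  have first: "0 < first_return_time g \<Delta> x" "R x = (g ^^ first_return_time g \<Delta> x) x" "R x \<in> \<Delta>"
    if "x \<in> \<Delta>" for x
    using LeastI_ex[OF ret[OF that]] by (auto simp: R_def first_return_map_def first_return_time_def)
  have le: "first_return_time g \<Delta> x \<le> m" if "0 < m" "(g ^^ m) x \<in> \<Delta>" for x m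
    using that by (auto simp: first_return_time_def intro: Least_le)
  have conj: "G (H x) = H (R x)" if "x \<in> \<Delta>" for x
    using that H(1) by (simp add: G R_def)
  obtain \<epsilon> E where \<epsilon>: "\<epsilon> > 0" and E: "Cr_diffeo_onto_image r E (ball q \<epsilon>)"
    and HE: "\<forall>y\<in>ball q \<epsilon>. circle_of y \<in> \<Delta> \<longrightarrow> H (circle_of y) = circle_of (E y)"
    using H(2) q unfolding local_Cr_diffeo_def by blast
  have qb: "q \<in> ball q \<epsilon>" using \<epsilon> by simp
  have Eq: "circle_of (E q) = H (circle_of q)" using HE qb q by auto
  have GlE: "Gl (E q) = E q" "(Gl has_real_derivative \<mu>) (at (E q))"
    using Glfix[OF Eq] by auto
  have "H (R (circle_of q)) = H (circle_of q)"
    using conj[OF q] Eq Gl[of "E q"] GlE by simp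
  then have Rq: "R (circle_of q) = circle_of q"
    using H(1) first(3)[OF q] q by (auto dest: inj_onD)
  show npos: "n > 0" and gq: "(g ^^ n) (circle_of q) = circle_of q"
    using first[OF q] Rq by (auto simp: n_def)
  \<comment> \<open>Earlier iterates miss \<open>\<Delta>\<close> altogether, in particular the
    point itself, so the return time \<open>n\<close> is its minimal period.\<close>
  have notin: "(g ^^ m) (circle_of q) \<notin> \<Delta>" if "0 < m" "m < n" for m
    using le[of m "circle_of q"] that by (auto simp: n_def)
  show "(g ^^ m) (circle_of q) \<noteq> circle_of q" if "0 < m" "m < n" for m
    using notin[OF that] q by auto
  obtain d where d: "d \<noteq> 0" "(E has_real_derivative d) (at q)"
    "(inv_into (ball q \<epsilon>) E has_real_derivative inverse d) (at (E q))"
    using Cr_diffeo_has_nonzero_deriv[OF E r qb] by blast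
  have injE: "inj_on E (ball q \<epsilon>)" and openE: "open (E ` ball q \<epsilon>)"
    using E by (auto simp: Cr_diffeo_onto_image_def)
  \<comment> \<open>\<open>W\<close> expresses the conjugate of \<open>G\<close> by \<open>H\<close>
    near \<open>q\<close>; its derivative there is \<open>\<mu>\<close> because the factors
    \<open>d\<close> and \<open>inverse d\<close> cancel.\<close>
  define W where "W y = inv_into (ball q \<epsilon>) E (Gl (E y))" for y
  have Wq: "W q = q" using injE qb by (simp add: W_def GlE)
  have GE: "((\<lambda>y. Gl (E y)) has_real_derivative \<mu> * d) (at q)"
    by (rule DERIV_chain2[OF GlE(2) d(2)])
  have "(W has_real_derivative inverse d * (\<mu> * d)) (at q)"
    unfolding W_def by (rule DERIV_chain2[OF _ GE]) (simp add: GlE d(3))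
  then have WD: "(W has_real_derivative \<mu>) (at q)" using d(1) by (simp add: field_simps)
  have "(F ^^ n) q - q \<in> \<int>" using gq by (simp add: pow circle_of_eq_iff)
  then obtain k where k: "(F ^^ n) q = q + of_int k"
    by (auto elim!: Ints_cases simp: algebra_simps)
  obtain \<sigma> \<delta> :: real where \<sigma>: "\<sigma> = 1 \<or> \<sigma> = -1" and \<delta>: "\<delta> > 0"
    "\<And>t. 0 < t \<Longrightarrow> t < \<delta> \<Longrightarrow> circle_of (q + \<sigma> * t) \<in> \<Delta>"
    using one_sided_in_submanifold[OF \<Delta> r q] by blast
  have \<sigma>2: "\<sigma> * \<sigma> = 1" using \<sigma> by auto
  \<comment> \<open>\<open>y t\<close> leaves \<open>q\<close> on the side \<open>\<sigma>\<close>
    contained in \<open>\<Delta>\<close>. The displacements \<open>a\<close> and \<open>b\<close> of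
    its images under \<open>W\<close> and the translated \<open>F ^^ n\<close> will agree for small
    \<open>t\<close>, which equates the derivatives.\<close>
  define y where "y t = q + \<sigma> * t" for t
  have yD: "(y has_real_derivative \<sigma>) (at 0)"
    unfolding y_def by (auto intro!: derivative_eq_intros)
  have y0: "y 0 = q" by (simp add: y_def)
  define a where "a t = \<sigma> * (W (y t) - q)" for t
  define b where "b t = \<sigma> * ((F ^^ n) (y t) - of_int k - q)" for t
  have aD: "(a has_real_derivative \<mu>) (at 0)"
    unfolding a_def
    by (rule derivative_eq_intros DERIV_chain2[OF _ yD] WD[folded y0] refl)+
      (use \<sigma>2 in \<open>simp add: algebra_simps\<close>)
  have bD: "(b has_real_derivative D) (at 0)"
    unfolding b_def
    by (rule derivative_eq_intros DERIV_chain2[OF _ yD] FD[folded y0] refl)+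
      (use \<sigma>2 in \<open>simp add: algebra_simps\<close>)
  have Wa: "W (y t) = q + \<sigma> * a t" and Fb: "(F ^^ n) (y t) - of_int k = q + \<sigma> * b t" for t
    using \<sigma> by (auto simp: a_def b_def)
  have ytend: "(y \<longlongrightarrow> q) (at_right 0)"
    unfolding y_def by (auto intro!: tendsto_eq_intros)
  have comp: "((\<lambda>t. f (y t)) \<longlongrightarrow> f q) (at_right 0)" if "isCont f q" for f :: "real \<Rightarrow> real"
    using isCont_tendsto_compose[OF that ytend] .
  have "eventually (\<lambda>t::real. t > 0) (at_right 0)" by (simp add: eventually_at_right_less)
  moreover have "eventually (\<lambda>t. 0 < t \<and> t < \<delta>) (at_right 0)"
    using eventually_at_right_pos_small[OF DERIV_ident _ _ \<delta>(1)] by simp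
  moreover have "eventually (\<lambda>t. 0 < a t \<and> a t < \<delta>) (at_right 0)"
    by (rule eventually_at_right_pos_small[OF aD _ \<mu> \<delta>(1)]) (simp add: a_def y0 Wq)
  moreover have "eventually (\<lambda>t. 0 < b t \<and> b t < \<delta>) (at_right 0)"
    by (rule eventually_at_right_pos_small[OF bD _ D \<delta>(1)]) (simp add: b_def y0 k)
  moreover have "eventually (\<lambda>t. y t \<in> ball q \<epsilon>) (at_right 0)"
    using topological_tendstoD[OF ytend open_ball qb] .
  moreover have "eventually (\<lambda>t. W (y t) \<in> ball q \<epsilon>) (at_right 0)"
    using topological_tendstoD[OF comp[OF DERIV_isCont[OF WD]] open_ball, of q \<epsilon>] qb Wq by simp
  moreover have "eventually (\<lambda>t. Gl (E (y t)) \<in> E ` ball q \<epsilon>) (at_right 0)"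
    using topological_tendstoD[OF comp[OF DERIV_isCont[OF GE]] openE] qb GlE by auto
  \<comment> \<open>No intermediate iterate of \<open>q\<close> lies over
    \<open>circle_of q\<close>. This open condition persists near \<open>q\<close> and excludes
    return times below \<open>n\<close>.\<close>
  moreover have "eventually (\<lambda>t. \<forall>m\<in>{0<..<n}. (F ^^ m) (y t) - W (y t) \<in> - \<int>) (at_right 0)"
  proof (intro eventually_ball_finite ballI)
    fix m assume m: "m \<in> {0<..<n}"
    then have "circle_of ((F ^^ m) q) \<noteq> circle_of q" using notin[of m] q by (auto simp: pow)
    then have "(F ^^ m) q - W q \<in> - \<int>" by (simp add: circle_of_eq_iff Wq)
    moreover have "((\<lambda>t. (F ^^ m) (y t) - W (y t)) \<longlongrightarrow> (F ^^ m) q - W q) (at_right 0)"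
      by (intro tendsto_diff comp F DERIV_isCont[OF WD])
    ultimately show "eventually (\<lambda>t. (F ^^ m) (y t) - W (y t) \<in> - \<int>) (at_right 0)"
      using topological_tendstoD[OF _ open_Compl[OF closed_Ints]] by blast
  qed auto
  \<comment> \<open>This difference will turn out to be an integer, so the bound \<open>1\<close>
    forces it to vanish.\<close>
  moreover have "eventually (\<lambda>t. \<bar>(F ^^ n) (y t) - of_int k - W (y t)\<bar> < 1) (at_right 0)"
  proof -
    have "((\<lambda>t. \<bar>(F ^^ n) (y t) - of_int k - W (y t)\<bar>) \<longlongrightarrow> \<bar>(F ^^ n) q - of_int k - W q\<bar>) (at_right 0)"
      by (intro tendsto_intros comp F DERIV_isCont[OF WD])
    then show ?thesis by (rule order_tendstoD) (simp add: k Wq)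
  qed
  ultimately have "eventually (\<lambda>t. a t / t = b t / t) (at_right 0)"
  proof eventually_elim
    case (elim t)
    let ?x = "circle_of (y t)"
    have x: "?x \<in> \<Delta>" using \<delta>(2) elim by (simp add: y_def)
    have w: "circle_of (W (y t)) \<in> \<Delta>" using \<delta>(2) elim by (simp add: Wa)
    \<comment> \<open>Since \<open>b t\<close> is positive and small, the \<open>n\<close>-th
      iterate lies in \<open>\<Delta>\<close>, so the first return occurs at time \<open>n\<close>
      at the latest.\<close>
    have b: "circle_of ((F ^^ n) (y t) - of_int k) \<in> \<Delta>" using \<delta>(2) elim by (simp add: Fb)
    have "circle_of ((F ^^ n) (y t) - of_int k) = (g ^^ n) ?x" by (simp add: pow circle_of_eq_iff)
    then have "first_return_time g \<Delta> ?x \<le> n" using b npos le by simp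
    \<comment> \<open>Injectivity of \<open>H\<close> on \<open>\<Delta>\<close> identifies the
      return map with \<open>W\<close> at this point.\<close>
    have "H (R ?x) = G (H ?x)" using conj[OF x] by simp
    also have "H ?x = circle_of (E (y t))" using HE elim x by blast
    also have "G \<dots> = circle_of (E (W (y t)))" using elim by (simp add: Gl W_def f_inv_into_f)
    also have "\<dots> = H (circle_of (W (y t)))" using HE elim w by auto
    finally have "R ?x = circle_of (W (y t))" using H(1) first(3)[OF x] w by (auto dest: inj_onD)
    then have *: "(F ^^ first_return_time g \<Delta> ?x) (y t) - W (y t) \<in> \<int>"
      using first(2)[OF x] by (simp add: pow circle_of_eq_iff)
    then have "first_return_time g \<Delta> ?x = n"
      using elim first(1)[OF x] \<open>first_return_time g \<Delta> ?x \<le> n\<close>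
      by (metis Compl_iff greaterThanLessThan_iff le_neq_implies_less)
    with * have "(F ^^ n) (y t) - W (y t) \<in> \<int>" by simp
    from Ints_diff[OF this Ints_of_int[of k]]
    have "(F ^^ n) (y t) - of_int k - W (y t) \<in> \<int>" by (simp add: algebra_simps)
    then obtain z where z: "(F ^^ n) (y t) - of_int k - W (y t) = of_int z" by (auto elim: Ints_cases)
    then have "\<bar>of_int z :: real\<bar> < 1" using elim by simp
    then have "z = 0" by linarith
    then have "(F ^^ n) (y t) - of_int k = W (y t)" using z by simp
    then show ?case by (simp add: a_def b_def)
  qed
  note ab = this
  have quot: "((\<lambda>t. f t / t) \<longlongrightarrow> l) (at_right 0)"
    if "(f has_real_derivative l) (at 0)" "f 0 = 0" for f :: "real \<Rightarrow> real" and l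
    using has_field_derivative_at_within[OF that(1), of "{0<..}"] that(2)
    by (simp add: has_field_derivative_iff)
  have "((\<lambda>t. a t / t) \<longlongrightarrow> \<mu>) (at_right 0)"
    by (rule quot[OF aD]) (simp add: a_def y0 Wq)
  moreover have "((\<lambda>t. b t / t) \<longlongrightarrow> D) (at_right 0)"
    by (rule quot[OF bD]) (simp add: b_def y0 k)
  then have "((\<lambda>t. a t / t) \<longlongrightarrow> D) (at_right 0)"
    using tendsto_cong[OF ab] by blast
  ultimately show "D = \<mu>"
    using tendsto_unique[OF trivial_limit_at_right_real] by blast
qed

section \<open>A path of diffeomorphisms\<close>

text \<open>A class closed under differentiation settles all finite orders and
  \<open>r = \<infinity>\<close> at once, without formulas for higher derivatives.\<close>

lemma Cr_on_if_closed_under_deriv: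
  assumes "f \<in> P" and der: "\<And>f x. f \<in> P \<Longrightarrow> \<exists>f'\<in>P. \<forall>x. (f has_real_derivative f' x) (at x)"
  shows "Cr_on r f S"
proof -
  have dP: "deriv f \<in> P \<and> f field_differentiable (at x)" if "f \<in> P" for f x
  proof -
    obtain f' where f': "f' \<in> P" "\<And>x. (f has_real_derivative f' x) (at x)" using der[OF \<open>f \<in> P\<close>] by blast
    then have "deriv f = f'" by (auto intro: DERIV_imp_deriv)
    then show ?thesis using f' by (auto simp: field_differentiable_def)
  qed
  have "(deriv ^^ k) f \<in> P" for k
    by (induction k) (use assms(1) dP in auto)
  then have "(deriv ^^ k) f field_differentiable (at x)" for k x using dP by blast
  then show ?thesis
    unfolding Cr_on_def
    by (auto intro: continuous_at_imp_continuous_on field_differentiable_imp_continuous_at)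
qed

lemma higher_deriv_eqI:
  fixes D :: "nat \<Rightarrow> real \<Rightarrow> real"
  assumes "\<And>k x. (D k has_real_derivative D (Suc k) x) (at x)"
  shows "(deriv ^^ k) (D 0) = D k"
proof (induction k)
  case (Suc k)
  then show ?case using assms by (auto intro: DERIV_imp_deriv)
qed simp

lemma Cr_on_derivative_tower:
  fixes D :: "nat \<Rightarrow> real \<Rightarrow> real"
  assumes "\<And>k x. (D k has_real_derivative D (Suc k) x) (at x)"
  shows "Cr_on r (D 0) S"
  by (rule Cr_on_if_closed_under_deriv[of _ "range D"]) (use assms in auto)

lemma Cr_on_subset: "Cr_on r F S \<Longrightarrow> T \<subseteq> S \<Longrightarrow> Cr_on r F T"
  unfolding Cr_on_def by (blast intro: continuous_on_subset)

text \<open>\<open>inv circle_of\<close> picks an arbitrary representative; the choice does not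
  matter when \<open>F\<close> commutes with integer translations.\<close>

definition circle_map :: "(real \<Rightarrow> real) \<Rightarrow> circle \<Rightarrow> circle" where
  "circle_map F c = circle_of (F (inv circle_of c))"

lemma circle_map_circle_of:
  assumes "\<And>x k. F (x + of_int k) = F x + of_int k"
  shows "circle_map F (circle_of x) = circle_of (F x)"
proof -
  have "circle_of (inv circle_of (circle_of x)) = circle_of x"
    by (rule surj_f_inv_f[OF surj_circle_of])
  then obtain k where "inv circle_of (circle_of x) = x + of_int k"
    unfolding circle_of_eq_iff by (metis Ints_cases add.commute diff_add_cancel)
  then show ?thesis by (simp add: circle_map_def assms circle_of_eq_iff)
qed

text \<open>The inverse lift also commutes with integer translations and induces the inverse map,
  and a global lift serves as local expression at every point.\<close>

lemma circle_map_in_Diff: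
  assumes F: "\<And>x k. F (x + of_int k) = F x + of_int k" and "bij F"
    and "Cr_on r F UNIV" "Cr_on r (inv F) UNIV"
  shows "circle_map F \<in> Diff r"
proof -
  have invF: "inv F (x + of_int k) = inv F x + of_int k" for x k
    using F[of "inv F x" k] assms(2) by (metis bij_inv_eq_iff)
  note eqs = circle_map_circle_of[of F, OF F] circle_map_circle_of[of "inv F", OF invF]
  have id: "circle_map (inv F) \<circ> circle_map F = id" "circle_map F \<circ> circle_map (inv F) = id"
  proof -
    show "circle_map (inv F) \<circ> circle_map F = id"
    proof
      fix c
      obtain x where "c = circle_of x" using surj_circle_of by blast
      then show "(circle_map (inv F) \<circ> circle_map F) c = id c"
        using assms(2) by (simp add: eqs bij_is_inj)
    qed
    show "circle_map F \<circ> circle_map (inv F) = id"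
    proof
      fix c
      obtain x where "c = circle_of x" using surj_circle_of by blast
      then show "(circle_map F \<circ> circle_map (inv F)) c = id c"
        using assms(2) by (simp add: eqs bij_is_surj surj_f_inv_f)
    qed
  qed
  have inv: "inv (circle_map F) = circle_map (inv F)"
    by (rule inv_unique_comp[OF id(2,1)])
  have "Cr_map r (circle_map F')" if "\<And>x. circle_map F' (circle_of x) = circle_of (F' x)" "Cr_on r F' UNIV" for F'
    unfolding Cr_map_def
  proof
    fix x
    show "\<exists>\<epsilon>>0. \<exists>F. Cr_on r F (ball x \<epsilon>) \<and> (\<forall>y\<in>ball x \<epsilon>. circle_map F' (circle_of y) = circle_of (F y))"
      using that Cr_on_subset[of r F' UNIV "ball x 1"]
      by (intro exI[of _ "1::real"] conjI exI[of _ F']) auto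
  qed
  then show ?thesis
    using o_bij[OF id] assms(3,4) eqs by (auto simp: Diff_def inv)
qed

text \<open>The factor \<open>t / (4 * pi)\<close> makes the derivative
  \<open>1 - t / 2 * cos (2 * pi * x)\<close>: positive for \<open>t\<close> in
  \<open>{0..1}\<close>, and \<open>1/2\<close> at the integers when \<open>t = 1\<close>. The
  parameter \<open>t\<close> serves as isotopy time.\<close>

definition sine_lift :: "real \<Rightarrow> real \<Rightarrow> real" where
  "sine_lift t x = x - t / (4 * pi) * sin (2 * pi * x)"

text \<open>Closed form of the \<open>k\<close>-th derivative: each differentiation of the sine
  multiplies by \<open>2 * pi\<close> and shifts the phase by \<open>pi / 2\<close>.\<close>

definition sine_lift_deriv :: "real \<Rightarrow> nat \<Rightarrow> real \<Rightarrow> real" where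
  "sine_lift_deriv t k x = (if k = 0 then x else if k = 1 then 1 else 0)
     - t / (4 * pi) * (2 * pi) ^ k * sin (2 * pi * x + of_nat k * (pi / 2))"

lemma sine_lift_deriv_0: "sine_lift_deriv t 0 = sine_lift t"
  by (rule ext) (simp add: sine_lift_deriv_def sine_lift_def)

lemma sine_lift_deriv_has_derivative:
  "(sine_lift_deriv t k has_real_derivative sine_lift_deriv t (Suc k) x) (at x)"
proof -
  have *: "sin (2 * pi * x + of_nat (Suc k) * (pi / 2)) = cos (2 * pi * x + of_nat k * (pi / 2))"
    by (simp add: sin_add cos_add algebra_simps add_divide_distrib)
  have "((\<lambda>x. (if k = 0 then x else if k = 1 then 1 else 0)) has_real_derivative
      (if Suc k = 0 then x else if Suc k = 1 then 1 else 0)) (at x)"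
    by (cases "k = 0") auto
  moreover have "((\<lambda>x. t / (4 * pi) * (2 * pi) ^ k * sin (2 * pi * x + of_nat k * (pi / 2)))
      has_real_derivative t / (4 * pi) * (2 * pi) ^ Suc k * sin (2 * pi * x + of_nat (Suc k) * (pi / 2))) (at x)"
    unfolding * by (auto intro!: derivative_eq_intros)
  ultimately show ?thesis
    unfolding sine_lift_deriv_def by (rule DERIV_diff)
qed

lemma higher_deriv_sine_lift: "(deriv ^^ k) (sine_lift t) = sine_lift_deriv t k"
  using higher_deriv_eqI[of "sine_lift_deriv t" k] sine_lift_deriv_has_derivative
  by (simp add: sine_lift_deriv_0)

lemma Cr_on_sine_lift: "Cr_on r (sine_lift t) S"
  using Cr_on_derivative_tower[of "sine_lift_deriv t" r S] sine_lift_deriv_has_derivative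
  by (simp add: sine_lift_deriv_0)

lemma sine_lift_DERIV:
  "(sine_lift t has_real_derivative 1 - t / 2 * cos (2 * pi * x)) (at x)"
  unfolding sine_lift_def by (auto intro!: derivative_eq_intros)

lemma sine_lift_add_int: "sine_lift t (x + of_int k) = sine_lift t x + of_int k"
proof -
  have "sin (2 * pi * (x + of_int k)) = sin (2 * pi * x)"
    by (simp add: distrib_left sin_add)
  then show ?thesis by (simp add: sine_lift_def)
qed

section \<open>Invertibility and smoothness of the inverse for parameters in the unit
  interval\<close>

context
  fixes t :: real
  assumes t: "0 \<le> t" "t \<le> 1"
begin

lemma sine_lift_deriv_pos: "1 - t / 2 * cos (2 * pi * x) > 0"
proof -
  have "t / 2 * cos (2 * pi * x) \<le> t / 2 * 1" using t by (intro mult_left_mono cos_le_one) auto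
  then show ?thesis using t by linarith
qed

lemma bij_sine_lift: "bij (sine_lift t)"
proof (rule bijI)
  show "inj (sine_lift t)"
    by (rule strict_mono_imp_inj_on, rule strict_mono_if_deriv_pos[OF sine_lift_DERIV sine_lift_deriv_pos])
  show "surj (sine_lift t)"
    unfolding surj_def
  proof
    fix y
    \<comment> \<open>Points move by at most \<open>1\<close>, so a preimage of \<open>y\<close> is
      bracketed by \<open>y - 1\<close> and \<open>y + 1\<close>.\<close>
    have "\<bar>t / (4 * pi) * sin (2 * pi * x)\<bar> \<le> 1" for x
    proof -
      have "\<bar>t / (4 * pi)\<bar> \<le> 1" using t pi_gt3 by (simp add: abs_mult field_simps)
      moreover have "\<bar>sin (2 * pi * x)\<bar> \<le> 1" by simp
      ultimately show ?thesis unfolding abs_mult by (intro mult_le_one) auto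
    qed
    then have "sine_lift t (y - 1) \<le> y" "y \<le> sine_lift t (y + 1)"
      unfolding sine_lift_def by (smt (verit))+
    then show "\<exists>x. y = sine_lift t x"
      using IVT[of "sine_lift t" "y - 1" y "y + 1"] DERIV_isCont[OF sine_lift_DERIV] by auto
  qed
qed

lemma inv_sine_lift_DERIV:
  "(inv (sine_lift t) has_real_derivative inverse (1 - t / 2 * cos (2 * pi * inv (sine_lift t) x))) (at x)"
proof -
  have "isCont (inv (sine_lift t)) (sine_lift t (inv (sine_lift t) x))"
    by (rule isCont_inverse_function[of 1])
      (use bij_sine_lift DERIV_isCont[OF sine_lift_DERIV] in \<open>auto simp: bij_is_inj\<close>)
  then have "isCont (inv (sine_lift t)) x"
    using bij_sine_lift by (simp add: bij_is_surj surj_f_inv_f)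
  then show ?thesis
    using sine_lift_deriv_pos[of "inv (sine_lift t) x"] bij_sine_lift
    by (intro DERIV_inverse_function[where f = "sine_lift t" and a = "x - 1" and b = "x + 1"])
      (auto simp: bij_is_surj surj_f_inv_f simp del: times_divide_eq_left intro: sine_lift_DERIV)
qed

text \<open>A class containing the inverse and closed under differentiation. Writing
  \<open>u\<close> for the function in rule \<open>inverse\<close> and \<open>s\<close> for the one
  in rule \<open>sin\<close>, the inverse has derivative \<open>u\<close>, and \<open>u\<close> has
  derivative \<open>- t * pi * s * u ^ 3\<close>.\<close>

inductive_set inverse_class :: "(real \<Rightarrow> real) set" where
  inv: "inv (sine_lift t) \<in> inverse_class"
| const: "(\<lambda>x. c) \<in> inverse_class"
| sin: "(\<lambda>x. sin (2 * pi * inv (sine_lift t) x)) \<in> inverse_class"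
| cos: "(\<lambda>x. cos (2 * pi * inv (sine_lift t) x)) \<in> inverse_class"
| inverse: "(\<lambda>x. inverse (1 - t / 2 * cos (2 * pi * inv (sine_lift t) x))) \<in> inverse_class"
| add: "f \<in> inverse_class \<Longrightarrow> g \<in> inverse_class \<Longrightarrow> (\<lambda>x. f x + g x) \<in> inverse_class"
| mult: "f \<in> inverse_class \<Longrightarrow> g \<in> inverse_class \<Longrightarrow> (\<lambda>x. f x * g x) \<in> inverse_class"

lemma inverse_class_deriv:
  "f \<in> inverse_class \<Longrightarrow> \<exists>f'\<in>inverse_class. \<forall>x. (f has_real_derivative f' x) (at x)"
proof (induction rule: inverse_class.induct)
  case inv
  show ?case by (rule bexI[OF _ inverse_class.inverse]) (use inv_sine_lift_DERIV in blast)
next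
  case (const c)
  show ?case by (rule bexI[OF _ inverse_class.const[of 0]]) auto
next
  case sin
  show ?case
    by (rule bexI[OF _ inverse_class.mult[OF inverse_class.mult[OF inverse_class.const[of "2*pi"] inverse_class.cos] inverse_class.inverse]])
      (auto intro!: derivative_eq_intros inv_sine_lift_DERIV)
next
  case cos
  show ?case
    by (rule bexI[OF _ inverse_class.mult[OF inverse_class.mult[OF inverse_class.const[of "-2*pi"] inverse_class.sin] inverse_class.inverse]])
      (auto intro!: derivative_eq_intros inv_sine_lift_DERIV)
next
  case inverse
  let ?u = "\<lambda>x. inverse (1 - t / 2 * cos (2 * pi * inv (sine_lift t) x))"
  let ?s = "\<lambda>x. sin (2 * pi * inv (sine_lift t) x)"
  have "(?u has_real_derivative (- t * pi) * (?s x * (?u x * (?u x * ?u x)))) (at x)" (is "(_ has_real_derivative ?d x) _") for x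
    using sine_lift_deriv_pos[of "inv (sine_lift t) x"]
    by (auto intro!: derivative_eq_intros inv_sine_lift_DERIV)
  moreover have "?d \<in> inverse_class"
    by (intro inverse_class.intros)
  ultimately show ?case by (intro bexI[of _ ?d]) auto
next
  case (add f g)
  then obtain f' g' where "f' \<in> inverse_class" "\<forall>x. (f has_real_derivative f' x) (at x)"
    "g' \<in> inverse_class" "\<forall>x. (g has_real_derivative g' x) (at x)" by blast
  then show ?case
    by (intro bexI[of _ "\<lambda>x. f' x + g' x"] inverse_class.intros) (auto intro: DERIV_add)
next
  case (mult f g)
  then obtain f' g' where "f' \<in> inverse_class" "\<forall>x. (f has_real_derivative f' x) (at x)"
    "g' \<in> inverse_class" "\<forall>x. (g has_real_derivative g' x) (at x)" by blast
  then show ?case using mult(1,2)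
    by (intro bexI[of _ "\<lambda>x. f' x * g x + g' x * f x"] inverse_class.intros) (auto intro: DERIV_mult)
qed

lemma sine_map_in_Diff: "circle_map (sine_lift t) \<in> Diff r"
  using circle_map_in_Diff[OF sine_lift_add_int bij_sine_lift Cr_on_sine_lift]
    Cr_on_if_closed_under_deriv[OF inverse_class.inv inverse_class_deriv] by blast

end

lemma Cr_lift_sine_lift: "Cr_lift r (circle_map (sine_lift t)) (sine_lift t)"
  by (simp add: Cr_lift_def Cr_on_sine_lift circle_map_circle_of sine_lift_add_int)

section \<open>Continuity of the sine family in the parameter\<close>

lemma sine_lift_deriv_diff_le:
  "\<bar>sine_lift_deriv s j x - sine_lift_deriv t j x\<bar> \<le> \<bar>s - t\<bar> * (2 * pi) ^ j"
proof -
  let ?A = "(2 * pi) ^ j" and ?S = "sin (2 * pi * x + of_nat j * (pi / 2))"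
  have "\<bar>sine_lift_deriv s j x - sine_lift_deriv t j x\<bar> = \<bar>(s - t) * ?A * (?S / (4 * pi))\<bar>"
    by (subst abs_minus_cancel[symmetric]) (simp add: sine_lift_deriv_def algebra_simps diff_divide_distrib)
  also have "\<dots> = \<bar>s - t\<bar> * ?A * \<bar>?S / (4 * pi)\<bar>" by (simp add: abs_mult)
  also have "\<bar>?S / (4 * pi)\<bar> \<le> 1"
  proof -
    have "\<bar>?S\<bar> \<le> 1" by simp
    then show ?thesis using pi_gt3 by (simp add: divide_le_eq del: abs_sin_le_one)
  qed
  finally show ?thesis by (simp add: mult_left_mono)
qed

lemma Ck_close_sine_maps:
  assumes "\<bar>s - t\<bar> * (2 * pi) ^ k < \<epsilon>"
  shows "Ck_close k \<epsilon> (circle_map (sine_lift s)) (circle_map (sine_lift t))"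
  unfolding Ck_close_def
proof (intro exI conjI allI impI)
  fix j x assume "j \<le> k"
  then have "(2 * pi) ^ j \<le> (2 * pi) ^ k" using pi_gt3 by (intro power_increasing) auto
  then have "\<bar>s - t\<bar> * (2 * pi) ^ j \<le> \<bar>s - t\<bar> * (2 * pi) ^ k" by (intro mult_left_mono) auto
  then show "\<bar>(deriv ^^ j) (sine_lift s) x - (deriv ^^ j) (sine_lift t) x\<bar> < \<epsilon>"
    unfolding higher_deriv_sine_lift using sine_lift_deriv_diff_le[of s j x t] assms by linarith
qed (rule Cr_lift_sine_lift)+

lemma circle_map_sine_lift_0: "circle_map (sine_lift 0) = id"
proof -
  have "sine_lift 0 = id" by (auto simp: sine_lift_def)
  then show ?thesis by (simp add: circle_map_def fun_eq_iff surj_f_inv_f[OF surj_circle_of])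
qed

lemma topspace_Cr_topology: "topspace (Cr_topology r) = Diff r"
proof -
  have "openin (Cr_topology r) (Diff r)"
    unfolding openin_Cr_topology by (auto intro!: exI[of _ "0::nat"] exI[of _ "1::real"] simp: zero_enat_def[symmetric])
  moreover have "S \<subseteq> Diff r" if "openin (Cr_topology r) S" for S
    using that by (simp add: openin_Cr_topology)
  ultimately show ?thesis unfolding topspace_def by blast
qed

text \<open>Basic neighbourhoods control only finitely many derivatives, each Lipschitz in
  \<open>t\<close> uniformly in \<open>x\<close>, so the path is continuous for
  \<open>r = \<infinity>\<close> as well.\<close>

lemma pathin_sine_maps: "pathin (Cr_topology r) (\<lambda>t. circle_map (sine_lift t))"
  unfolding pathin_def continuous_map_alt
proof (intro conjI allI impI)
  show "(\<lambda>t. circle_map (sine_lift t)) \<in> topspace (top_of_set {0..1}) \<rightarrow> topspace (Cr_topology r)"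
    by (auto simp: topspace_Cr_topology sine_map_in_Diff)
  fix U assume U: "openin (Cr_topology r) U"
  let ?S = "(\<lambda>t. circle_map (sine_lift t)) -` U \<inter> topspace (top_of_set {0..1})"
  show "openin (top_of_set {0..1}) ?S"
    unfolding openin_euclidean_subtopology_iff
  proof (intro conjI ballI)
    fix t assume t: "t \<in> ?S"
    then obtain k \<epsilon> where k: "0 < \<epsilon>" "{g \<in> Diff r. Ck_close k \<epsilon> (circle_map (sine_lift t)) g} \<subseteq> U"
      using U unfolding openin_Cr_topology by auto
    have pos: "(2 * pi) ^ k > 0" by simp
    show "\<exists>e>0. \<forall>s\<in>{0..1}. dist s t < e \<longrightarrow> s \<in> ?S"
    proof (intro exI[of _ "\<epsilon> / (2 * pi) ^ k"] conjI ballI impI)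
      fix s :: real assume s: "s \<in> {0..1}" "dist s t < \<epsilon> / (2 * pi) ^ k"
      then have "\<bar>t - s\<bar> * (2 * pi) ^ k < \<epsilon>"
        using pos by (simp add: dist_real_def abs_minus_commute pos_less_divide_eq)
      then have "circle_map (sine_lift s) \<in> U"
        using k(2) Ck_close_sine_maps sine_map_in_Diff s by auto
      then show "s \<in> ?S" using s by simp
    qed (use k pos in auto)
  qed auto
qed

section \<open>Compactness of the circle and isotopy to the identity\<close>

lemma continuous_circle_of: "continuous_on UNIV circle_of"
  unfolding continuous_on_open_vimage[OF open_UNIV] by (auto simp: open_circle_def)

lemma compact_UNIV_circle: "compact (UNIV :: circle set)"
proof -
  have "continuous_on {0..1} circle_of"
    using continuous_circle_of continuous_on_subset by blast
  then have "compact (circle_of ` {0..1})" by (intro compact_continuous_image) auto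
  moreover have "c \<in> circle_of ` {0..1}" for c
  proof -
    obtain x where "c = circle_of x" using surj_circle_of by blast
    then have "c = circle_of (frac x)" by (simp add: circle_of_eq_iff frac_def)
    then show ?thesis using frac_lt_1[of x] frac_ge_0[of x] by (intro image_eqI[of _ _ "frac x"]) auto
  qed
  then have "circle_of ` {0..1} = UNIV" by blast
  ultimately show ?thesis by simp
qed

lemma sine_map_in_Diff_c: "circle_map (sine_lift 1) \<in> Diff_c r"
  unfolding Diff_c_def
  using pathin_sine_maps circle_map_sine_lift_0
    compact_Int_closed[OF compact_UNIV_circle closed_closure]
  by (auto intro!: exI[of _ "\<lambda>t. circle_map (sine_lift t)"])

lemma sine_map_in_Diff_0: "circle_map (sine_lift 1) \<in> Diff_0 r"
proof -
  have "path_component_of (Cr_topology r) id (circle_map (sine_lift 1))"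
    unfolding path_component_of_def
    using pathin_sine_maps circle_map_sine_lift_0 by (intro exI[of _ "\<lambda>t. circle_map (sine_lift t)"]) auto
  then show ?thesis
    unfolding Diff_0_def by (simp add: path_imp_connected_component_of)
qed

section \<open>A neighbourhood of the identity\<close>

text \<open>The difference of two lifts is continuous and integer valued, hence constant. In
  particular all lifts have the same derivatives.\<close>

lemma Cr_lift_unique:
  assumes "Cr_lift r f F" "Cr_lift r f G"
  obtains c where "F = (\<lambda>x. G x + c)"
proof -
  have "continuous_on UNIV F" "continuous_on UNIV G"
    using assms unfolding Cr_lift_def Cr_on_def by (metis funpow_0 i0_lb zero_enat_def)+
  then have cont: "continuous_on UNIV (\<lambda>x. F x - G x)" by (intro continuous_on_diff)
  have int: "F x - G x \<in> \<int>" for x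
    using assms by (metis Cr_lift_def circle_of_eq_iff)
  have "(\<lambda>x. F x - G x) constant_on UNIV"
  proof (rule continuous_discrete_range_constant[OF connected_UNIV cont])
    fix x
    have "1 \<le> norm ((F y - G y) - (F x - G x))" if "F y - G y \<noteq> F x - G x" for y
    proof -
      obtain m n where "F y - G y = of_int m" "F x - G x = of_int n"
        using int by (meson Ints_cases)
      then show ?thesis using that by (simp flip: of_int_diff of_int_abs)
    qed
    then show "\<exists>e>0. \<forall>y. y \<in> UNIV \<and> F y - G y \<noteq> F x - G x \<longrightarrow> e \<le> norm (F y - G y - (F x - G x))"
      by (intro exI[of _ 1]) auto
  qed
  then obtain c where "\<And>x. F x - G x = c" unfolding constant_on_def by blast
  then show ?thesis using that[of c] by (auto simp: algebra_simps)
qed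

text \<open>The bound \<open>\<eta> < \<delta>\<close> is uniform in \<open>x\<close>, which leaves
  the room needed for openness. The values of \<open>F\<close> are not constrained, so only
  derivatives count and rotations are not told apart.\<close>

definition near_rotation :: "enat \<Rightarrow> real \<Rightarrow> (circle \<Rightarrow> circle) set" where
  "near_rotation r \<delta> = {g \<in> Diff r. \<exists>\<eta><\<delta>. \<exists>F. Cr_lift 2 g F \<and>
     (\<forall>x. \<bar>deriv F x - 1\<bar> \<le> \<eta> \<and> \<bar>(deriv ^^ 2) F x\<bar> \<le> \<eta>)}"

lemma openin_near_rotation:
  assumes "2 \<le> r"
  shows "openin (Cr_topology r) (near_rotation r \<delta>)"
  unfolding openin_Cr_topology
proof (intro conjI ballI)
  fix f assume "f \<in> near_rotation r \<delta>"
  then obtain \<eta> F where \<eta>: "\<eta> < \<delta>" and F: "Cr_lift 2 f F"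
    and bd: "\<And>x. \<bar>deriv F x - 1\<bar> \<le> \<eta>" "\<And>x. \<bar>(deriv ^^ 2) F x\<bar> \<le> \<eta>"
    unfolding near_rotation_def by blast
  have two: "enat 2 = 2" by (simp add: numeral_eq_enat)
  have diff: "F field_differentiable (at x)" for x
    using F unfolding Cr_lift_def Cr_on_def
    by (metis UNIV_I enat_ord_simps(2) funpow_0 pos2 two)
  \<comment> \<open>The radius is half of the slack: the bound \<open>\<eta>\<close> grows to at
    most \<open>(\<delta> + \<eta>) / 2\<close>, which is still below
    \<open>\<delta>\<close>.\<close>
  have "{g \<in> Diff r. Ck_close 2 ((\<delta> - \<eta>) / 2) f g} \<subseteq> near_rotation r \<delta>"
  proof clarify
    fix g assume g: "g \<in> Diff r" "Ck_close 2 ((\<delta> - \<eta>) / 2) f g"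
    then obtain A B where A: "Cr_lift 2 f A" and B: "Cr_lift 2 g B"
      and close: "\<And>j x. j \<le> 2 \<Longrightarrow> \<bar>(deriv ^^ j) A x - (deriv ^^ j) B x\<bar> < (\<delta> - \<eta>) / 2"
      unfolding Ck_close_def two by blast
    \<comment> \<open>Closeness may be witnessed by another lift \<open>A\<close> of
      \<open>f\<close>, but its derivatives are those of \<open>F\<close>.\<close>
    obtain c where c: "A = (\<lambda>x. F x + c)" using Cr_lift_unique[OF A F] .
    have dA: "deriv A = deriv F" using diff by (simp add: c fun_eq_iff)
    then have ddA: "(deriv ^^ 2) A = (deriv ^^ 2) F" by (simp add: numeral_2_eq_2)
    have "\<bar>deriv B x - 1\<bar> \<le> (\<delta> + \<eta>) / 2 \<and> \<bar>(deriv ^^ 2) B x\<bar> \<le> (\<delta> + \<eta>) / 2" for x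
      using close[of 1 x] close[of 2 x] bd[of x] unfolding ddA by (simp add: dA) argo
    moreover have "(\<delta> + \<eta>) / 2 < \<delta>" using \<eta> by simp
    ultimately show "g \<in> near_rotation r \<delta>"
      using g B unfolding near_rotation_def by blast
  qed
  then show "\<exists>k \<epsilon>. enat k \<le> r \<and> 0 < \<epsilon> \<and> {g \<in> Diff r. Ck_close k \<epsilon> f g} \<subseteq> near_rotation r \<delta>"
    using assms \<eta> by (intro exI[of _ 2] exI[of _ "(\<delta> - \<eta>) / 2"]) (auto simp: two)
qed (auto simp: near_rotation_def)

lemma id_in_near_rotation:
  assumes "\<delta> > 0"
  shows "id \<in> near_rotation r \<delta>"
proof -
  have "deriv (sine_lift 0) = (\<lambda>x. 1)" "(deriv ^^ 2) (sine_lift 0) = (\<lambda>x. 0)"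
    using higher_deriv_sine_lift[of 1 0] higher_deriv_sine_lift[of 2 0]
    by (simp_all add: sine_lift_deriv_def fun_eq_iff)
  moreover have "Cr_lift 2 id (sine_lift 0)" "id \<in> Diff r"
    using Cr_lift_sine_lift[of 2 0] sine_map_in_Diff[of 0 r] by (simp_all add: circle_map_sine_lift_0)
  ultimately show ?thesis
    unfolding near_rotation_def using assms by (auto intro!: exI[of _ "0::real"])
qed

text \<open>Conjugation forces the multiplier \<open>1/2\<close> at the preimage under
  \<open>H\<close> of the fixed point, while the derivative bounds force a multiplier above
  \<open>1/2\<close>.\<close>

lemma not_total_renormalization_of_near_rotation:
  assumes r: "2 \<le> r" and g: "g \<in> near_rotation r (1/10)"
  shows "\<not> total_renormalization r (circle_map (sine_lift 1)) g"
proof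
  let ?G = "circle_map (sine_lift 1)"
  assume "total_renormalization r ?G g"
  then obtain \<Delta> H where \<Delta>: "submanifold_with_corners r \<Delta>" and H: "bij_betw H \<Delta> UNIV" "local_Cr_diffeo r \<Delta> H"
    and ret: "bounded_first_return g \<Delta>" and G: "?G = H \<circ> first_return_map g \<Delta> \<circ> inv_into \<Delta> H"
    unfolding total_renormalization_def by blast
  obtain \<eta> F where \<eta>: "\<eta> < 1/10" and F: "Cr_lift 2 g F"
    and bd: "\<And>x. \<bar>deriv F x - 1\<bar> \<le> \<eta>" "\<And>x. \<bar>(deriv ^^ 2) F x\<bar> \<le> \<eta>"
    using g unfolding near_rotation_def by blast
  have injg: "inj g" using g by (auto simp: near_rotation_def Diff_def bij_is_inj)
  have lift: "g (circle_of x) = circle_of (F x)" for x using F by (simp add: Cr_lift_def)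
  have "(deriv ^^ k) F field_differentiable (at x)" if "k < 2" for k x
    using F that unfolding Cr_lift_def Cr_on_def by (simp add: numeral_eq_enat)
  from this[of 0] this[of 1]
  have der: "(F has_real_derivative deriv F x) (at x)"
    and der2: "(deriv F has_real_derivative (deriv ^^ 2) F x) (at x)" for x
    by (simp_all add: DERIV_deriv_iff_field_differentiable numeral_2_eq_2)
  have near1: "\<bar>deriv F x - 1\<bar> \<le> 1/10" for x using bd(1)[of x] \<eta> by linarith
  have lip: "\<bar>deriv F x - deriv F y\<bar> \<le> \<bar>x - y\<bar> / 10" for x y
  proof -
    have "norm (deriv F x - deriv F y) \<le> 1/10 * norm (x - y)"
    proof (rule field_differentiable_bound[of UNIV])
      show "norm ((deriv ^^ 2) F z) \<le> 1/10" for z using bd(2)[of z] \<eta> by simp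
    qed (use der2 in auto)
    then show ?thesis by simp
  qed
  have Fpos: "deriv F x > 0" for x using near1[of x] by linarith
  obtain p where p: "p \<in> \<Delta>" "H p = circle_of 0" using H(1) by (metis UNIV_I bij_betw_iff_bijections)
  obtain q where q: "p = circle_of q" using surj_circle_of by blast
  define n where "n = first_return_time g \<Delta> (circle_of q)"
  let ?D = "\<Prod>j<n. deriv F ((F ^^ j) q)"
  \<comment> \<open>Every lift of the fixed point is an integer, and all integers are fixed with
    slope \<open>1/2\<close>, whichever of them the local expression of \<open>H\<close>
    selects.\<close>
  have fixed: "sine_lift 1 y = y \<and> (sine_lift 1 has_real_derivative 1/2) (at y)"
    if "circle_of y = H (circle_of q)" for y
  proof -
    have "y \<in> \<int>" using that p q by (simp add: circle_of_eq_iff)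
    then obtain k where k: "y = of_int k" by (auto elim: Ints_cases)
    show ?thesis using sine_lift_DERIV[of 1 y] sine_lift_add_int[of 1 0 k]
      by (simp add: k) (simp add: sine_lift_def)
  qed
  have "1 \<le> r" using r by (meson one_le_numeral order_trans)
  have ret': "\<exists>m>0. (g ^^ m) x \<in> \<Delta>" if "x \<in> \<Delta>" for x
    using ret that by (simp add: bounded_first_return_def)
  have G_lift: "?G (circle_of x) = circle_of (sine_lift 1 x)" for x
    by (simp add: circle_map_circle_of sine_lift_add_int)
  have Dpos: "?D > 0" using Fpos by (simp add: prod_pos)
  have F_cont: "isCont (F ^^ m) q" for m
    using DERIV_isCont[OF funpow_has_real_derivative[of F, OF der]] .
  have FD: "((F ^^ n) has_real_derivative ?D) (at q)"
    using funpow_has_real_derivative[of F, OF der] .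
  have q\<Delta>: "circle_of q \<in> \<Delta>" using p(1) q by simp
  have H_inj: "inj_on H \<Delta>" using H(1) by (rule bij_betw_imp_inj_on)
  have half: "(0::real) < 1/2" by simp
  note ren = first_return_multiplier_eq[where g = g and F = F and Gl = "sine_lift 1" and \<mu> = "1/2"
      and D = ?D and q = q and n = n,
      OF \<Delta> \<open>1 \<le> r\<close> q\<Delta> H_inj H(2) G ret' lift G_lift fixed half F_cont n_def FD Dpos]
  have "?D > 1/2"
    by (rule periodic_point_multiplier_gt_half[OF lift injg der near1 lip ren(2,3)]) (use ren(4) in auto)
  with ren(1) show False by simp
qed

theorem proposition0p10:
  fixes r :: enat
  assumes "2 \<le> r"
  shows "\<exists>N. Cr_neighborhood_of_id r N \<and>
           (\<exists>G. G \<in> Diff_c r \<and> G \<in> Diff_0 r \<and> (\<forall>g\<in>N. \<not> total_renormalization r G g))"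
proof (intro exI[of _ "near_rotation r (1/10)"] conjI exI[of _ "circle_map (sine_lift 1)"] ballI)
  show "Cr_neighborhood_of_id r (near_rotation r (1/10))"
    unfolding Cr_neighborhood_of_id_def
  proof (intro conjI exI[of _ "near_rotation r (1/10)"])
    show "near_rotation r (1/10) \<subseteq> Diff r" by (auto simp: near_rotation_def)
    show "id \<in> near_rotation r (1/10)" by (rule id_in_near_rotation) simp
  qed (use openin_near_rotation[OF assms] in auto)
qed (use sine_map_in_Diff_c sine_map_in_Diff_0 not_total_renormalization_of_near_rotation[OF assms] in auto)

end
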